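(* Every generalised triple homomorphism between JB$^*$-triples is continuous.
   Context: A complex Jordan Banach triple is a complex Banach space $E$ with a continuous triple product $\{\cdot,\cdot,\cdot\}:E^3\to E$ that is bilinear and symmetric in the outer variables and conjugate linear in the middle one, satisfying the Jordan identity $L(a,b)L(x,y)-L(x,y)L(a,b)=L(L(a,b)x,y)-L(x,L(b,a)y)$, where $L(x,y)z=\{x,y,z\}$. A JB$^*$-triple is a complex Jordan Banach triple $E$ such that, for every $a\in E$, $L(a,a)$ is a hermitian operator with non-negative spectrum, and $\|\{a,a,a\}\|=\|a\|^3$. A (not necessarily continuous) linear mapping $T:E\to F$ between Jordan Banach triples is a generalised triple homomorphism if there is $C>0$ with $\|T(\{a,b,c\})-\{T(a),T(b),T(c)\}\|\le C\|a\|\|b\|\|c\|$ for all $a,b,c\in E$. *)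

theory Defs
  imports "HOL-Analysis.Analysis"
begin

section \<open>Complex Banach spaces and their operators\<close>

text \<open>The zero space is allowed as a complex Banach space.\<close>

class cbanach = banach +
  fixes scaleC :: "complex \<Rightarrow> 'a \<Rightarrow> 'a"  (infixr \<open>*\<^sub>C\<close> 75)
  assumes scaleC_add_right: "c *\<^sub>C (x + y) = c *\<^sub>C x + c *\<^sub>C y"
    and scaleC_add_left: "(c + d) *\<^sub>C x = c *\<^sub>C x + d *\<^sub>C x"
    and scaleC_scaleC: "c *\<^sub>C (d *\<^sub>C x) = (c * d) *\<^sub>C x"
    and scaleC_of_real: "complex_of_real r *\<^sub>C x = r *\<^sub>R x"
    and norm_scaleC: "norm (c *\<^sub>C x) = cmod c * norm x"

definition clinear :: "('a::cbanach \<Rightarrow> 'b::cbanach) \<Rightarrow> bool" where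
  "clinear T \<longleftrightarrow> Vector_Spaces.linear scaleC scaleC T"

definition bounded_clinear :: "('a::cbanach \<Rightarrow> 'b::cbanach) \<Rightarrow> bool" where
  "bounded_clinear T \<longleftrightarrow> clinear T \<and> (\<exists>K. \<forall>x. norm (T x) \<le> K * norm x)"

text \<open>The spectrum is taken in the algebra of bounded operators, so an inverse has to be bounded.\<close>

definition spectrum :: "('a::cbanach \<Rightarrow> 'a) \<Rightarrow> complex set" where
  "spectrum T = {\<mu>. \<not> (\<exists>S. bounded_clinear S \<and>
     S \<circ> (\<lambda>x. T x - \<mu> *\<^sub>C x) = id \<and> (\<lambda>x. T x - \<mu> *\<^sub>C x) \<circ> S = id)}"

text \<open>The exponential series of an operator, summed pointwise; for a bounded operator it converges
  absolutely and its sum is the exponential in the Banach algebra of bounded operators.\<close>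

definition op_exp :: "('a::cbanach \<Rightarrow> 'a) \<Rightarrow> 'a \<Rightarrow> 'a" where
  "op_exp T x = (\<Sum>n. (T ^^ n) x /\<^sub>R fact n)"

text \<open>A bounded operator is hermitian if \<open>exp (i t T)\<close> is an isometry for every real \<open>t\<close>.
  For nonzero spaces this is the condition that \<open>exp (i t T)\<close> has norm one for every real \<open>t\<close>;
  the operators \<open>exp (i t T)\<close> and \<open>exp (- i t T)\<close> are mutually inverse.\<close>

definition hermitian :: "('a::cbanach \<Rightarrow> 'a) \<Rightarrow> bool" where
  "hermitian T \<longleftrightarrow> bounded_clinear T \<and>
     (\<forall>t::real. \<forall>x. norm (op_exp (\<lambda>y. (\<i> * complex_of_real t) *\<^sub>C T y) x) = norm x)"

section \<open>Jordan Banach triples\<close>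

text \<open>A triple product is a curried function \<open>tp\<close>, so that the operator \<open>L(x,y)\<close> is the
  partial application \<open>tp x y\<close>.\<close>

locale jordan_banach_triple =
  fixes tp :: "'a::cbanach \<Rightarrow> 'a \<Rightarrow> 'a \<Rightarrow> 'a"
  assumes outer_sym: "tp x y z = tp z y x"
    and outer_linear: "clinear (tp x y)"
    and middle_add: "tp x (y + y') z = tp x y z + tp x y' z"
    and middle_scaleC: "tp x (c *\<^sub>C y) z = cnj c *\<^sub>C tp x y z"
    and tp_continuous: "continuous_on UNIV (\<lambda>(x, y, z). tp x y z)"
    and jordan_identity:
      "tp a b (tp x y z) - tp x y (tp a b z) = tp (tp a b x) y z - tp x (tp b a y) z"

locale jb_star_triple = jordan_banach_triple +
  assumes hermitian_L: "hermitian (tp a a)"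
    and spectrum_L: "spectrum (tp a a) \<subseteq> \<real>\<^sub>\<ge>\<^sub>0"
    and norm_cube: "norm (tp a a a) = norm a ^ 3"

definition generalised_triple_hom ::
  "('a::cbanach \<Rightarrow> 'a \<Rightarrow> 'a \<Rightarrow> 'a) \<Rightarrow> ('b::cbanach \<Rightarrow> 'b \<Rightarrow> 'b \<Rightarrow> 'b) \<Rightarrow> ('a \<Rightarrow> 'b) \<Rightarrow> bool" where
  "generalised_triple_hom tpE tpF T \<longleftrightarrow> clinear T \<and>
     (\<exists>C>0. \<forall>a b c. norm (T (tpE a b c) - tpF (T a) (T b) (T c)) \<le> C * norm a * norm b * norm c)"

end

theory Submission
  imports Defs
begin

text \<open>Let \<open>a\<close> be small, so that \<open>L = L(a,a)\<close> has norm at most \<open>1/2\<close>. The element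
  \<open>f = (L + \<i> sqrt (1 - L\<^sup>2)) a\<close> and its conjugate \<open>g = (L - \<i> sqrt (1 - L\<^sup>2)) a\<close> then exist. As powers
  of \<open>a\<close> associate and the middle variable is conjugate linear, \<open>{f,f,f} = {a,a,f}\<close>, and similarly for
  \<open>g\<close>. Applying \<open>T\<close> and \<open>norm {z,z,z} = norm z ^ 3\<close> in the codomain, \<open>norm (T f) ^ 3\<close> is at most
  \<open>M * norm (T a) ^ 2 * norm (T f)\<close> up to an additive constant, so \<open>T f\<close> and \<open>T g\<close> are bounded linearly in
  \<open>norm (T a)\<close>. But \<open>f + g = 2 {a,a,a}\<close>, so \<open>norm (T a) ^ 3\<close> is bounded linearly in \<open>norm (T a)\<close> as
  well, which bounds \<open>T\<close> on a neighbourhood of zero.\<close>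

section \<open>Complex linear maps\<close>

lemma clinear_add: "clinear T \<Longrightarrow> T (x + y) = T x + T y"
  unfolding clinear_def linear_iff_module_hom by (rule module_hom.add)

lemma clinear_scaleC: "clinear T \<Longrightarrow> T (c *\<^sub>C x) = c *\<^sub>C T x"
  unfolding clinear_def linear_iff_module_hom by (rule module_hom.scale)

lemma clinear_imp_linear: "clinear T \<Longrightarrow> linear T"
  by (rule linearI) (simp_all add: clinear_add clinear_scaleC flip: scaleC_of_real)

lemma scaleC_minus_left: "(- c) *\<^sub>C x = - (c *\<^sub>C (x::'a::cbanach))"
  by (metis add.right_inverse add_eq_0_iff scaleC_add_left scaleC_of_real of_real_0 scaleR_zero_left)

section \<open>The binomial series of the square root and its formal square\<close>

text \<open>The coefficients of the power series of \<open>sqrt (1 - x)\<close>.\<close>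

definition sqrt_coeff :: "nat \<Rightarrow> real" where
  "sqrt_coeff k = (-1) ^ k * ((1/2) gchoose k)"

text \<open>Consecutive coefficients have ratio \<open>(k - 1/2) / (k + 1)\<close>, of modulus at
  most 1. This crude bound suffices, since the series are summed against geometric decay.\<close>

lemma abs_sqrt_coeff_le: "\<bar>sqrt_coeff k\<bar> \<le> 1"
proof (induction k)
  case (Suc k)
  have "sqrt_coeff (Suc k) = sqrt_coeff k * ((real k - 1/2) / (real k + 1))"
    unfolding sqrt_coeff_def gbinomial_Suc_rec
    by (simp add: gbinomial_absorb_comp gbinomial_absorption' field_simps)
  moreover have "\<bar>(real k - 1/2) / (real k + 1)\<bar> \<le> 1"
    by (simp add: abs_le_iff field_simps)
  ultimately show ?case
    using Suc by (simp only: abs_mult mult_le_one abs_ge_zero)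
qed (simp add: sqrt_coeff_def)

text \<open>The square of the series of sqrt (1 - x) is 1 - x; coefficientwise this is Vandermonde's
  identity for 1/2 + 1/2 = 1.\<close>

lemma sqrt_coeff_convolution:
  "(\<Sum>k\<le>n. sqrt_coeff k * sqrt_coeff (n - k)) = (if n = 0 then 1 else if n = 1 then -1 else 0)"
proof -
  have "(\<Sum>k\<le>n. sqrt_coeff k * sqrt_coeff (n - k))
      = (\<Sum>k\<le>n. (-1) ^ n * (((1/2) gchoose k) * ((1/2) gchoose (n - k))))"
    by (rule sum.cong) (auto simp: sqrt_coeff_def simp flip: power_add)
  also have "\<dots> = (-1) ^ n * ((1::real) gchoose n)"
    using gbinomial_Vandermonde[of "1/2::real" "1/2" n]
    by (simp add: atMost_atLeast0 flip: sum_distrib_left)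
  also have "(1::real) gchoose n = real (1 choose n)"
    using binomial_gbinomial[of 1 n, where 'a=real] by simp
  finally show ?thesis
    by (cases n rule: nat.exhaust) (auto simp: binomial_eq_0 numeral_2_eq_2 split: if_splits)
qed

text \<open>The ratio 1/4 arises because only every second power of an operator of norm at most 1/2
  occurs. The geometric sum is \<open>4/3 * B\<close>, rounded up to \<open>2 * B\<close>.\<close>

lemma geometric_suminf_bound:
  fixes x :: "nat \<Rightarrow> 'a::banach"
  assumes "0 \<le> B" and "\<And>n. norm (x n) \<le> B / 4 ^ n"
  shows "summable (\<lambda>n. norm (x n))" and "summable x" and "norm (\<Sum>n. x n) \<le> 2 * B"
proof -
  have g: "(\<lambda>n. B * (1/4) ^ n) sums (B * (1 / (1 - 1/4)))"
    by (intro sums_mult geometric_sums) simp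
  show s: "summable (\<lambda>n. norm (x n))"
    by (rule summable_comparison_test'[OF sums_summable[OF g], of 0])
      (use assms(2) in \<open>simp add: power_divide\<close>)
  then show "summable x" by (rule summable_norm_cancel)
  have "norm (\<Sum>n. x n) \<le> (\<Sum>n. norm (x n))" by (rule summable_norm[OF s])
  also have "\<dots> \<le> (\<Sum>n. B * (1/4) ^ n)"
    by (rule suminf_le[OF _ s sums_summable[OF g]]) (use assms(2) in \<open>simp add: power_divide\<close>)
  also have "\<dots> \<le> 2 * B" using sums_unique[OF g] assms(1) by simp
  finally show "norm (\<Sum>n. x n) \<le> 2 * B" .
qed

text \<open>This is sqrt (1 - x) * sqrt (1 - x) = 1 - x with the vector \<open>x n\<close> in place
  of the n-th power. Absolute summability allows the double family to be summed by rows, which gives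
  the left side, and by antidiagonals, where the convolution leaves two terms.\<close>

lemma sqrt_coeff_double_sum:
  fixes x :: "nat \<Rightarrow> 'a::banach"
  assumes "0 \<le> B" and x: "\<And>n. norm (x n) \<le> B / 4 ^ n"
  shows "(\<Sum>k. sqrt_coeff k *\<^sub>R (\<Sum>l. sqrt_coeff l *\<^sub>R x (k + l))) = x 0 - x 1"
proof -
  define g where "g = (\<lambda>(k, l). sqrt_coeff k *\<^sub>R sqrt_coeff l *\<^sub>R x (k + l))"
  have coeff: "\<bar>sqrt_coeff k * sqrt_coeff l\<bar> \<le> 1" for k l
    by (simp add: abs_mult abs_sqrt_coeff_le mult_le_one)
  have le: "norm (g (k, l)) \<le> (B / 4 ^ k) / 4 ^ l" for k l
  proof -
    have "norm (g (k, l)) = \<bar>sqrt_coeff k * sqrt_coeff l\<bar> * norm (x (k + l))"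
      by (simp add: g_def abs_mult)
    also have "\<dots> \<le> 1 * (B / 4 ^ (k + l))"
      by (intro mult_mono coeff x) simp_all
    finally show ?thesis by (simp add: power_add)
  qed
  have row: "summable (\<lambda>l. norm (g (k, l)))" "summable (\<lambda>l. g (k, l))" for k
    using geometric_suminf_bound(1,2)[of "B / 4 ^ k" "\<lambda>l. g (k, l)"] le assms(1) by auto
  have bound: "(\<lambda>(k, l). (B / 4 ^ k) / 4 ^ l) summable_on (UNIV :: nat set) \<times> (UNIV :: nat set)"
  proof (rule summable_on_SigmaI)
    show "((\<lambda>l. (\<lambda>(k, l). (B / 4 ^ k) / 4 ^ l) (k, l)) has_sum (B / 4 ^ k) * (4 / 3)) UNIV"
      for k :: nat
    proof (rule norm_summable_imp_has_sum)
      have "(\<lambda>l. (B / 4 ^ k) * (1/4) ^ l) sums ((B / 4 ^ k) * (1 / (1 - 1/4)))"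
        by (intro sums_mult geometric_sums) simp
      then show "(\<lambda>l. (\<lambda>(k, l). (B / 4 ^ k) / 4 ^ l) (k, l)) sums ((B / 4 ^ k) * (4 / 3))"
        by (simp add: power_divide)
      then show "summable (\<lambda>l. norm ((\<lambda>(k, l). (B / 4 ^ k) / 4 ^ l) (k, l)))"
        using assms(1) by (simp add: sums_iff)
    qed
    show "(\<lambda>k::nat. (B / 4 ^ k) * (4 / 3)) summable_on UNIV"
    proof (rule norm_summable_imp_summable_on)
      show "summable (\<lambda>k::nat. norm ((B / 4 ^ k) * (4 / 3)))"
        using summable_mult[OF summable_geometric[of "1/4::real"], of "B * (4 / 3)"] assms(1)
        by (simp add: power_divide ac_simps)
    qed
  qed (use assms(1) in auto)
  have "(\<lambda>p. norm (g p)) summable_on UNIV \<times> UNIV"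
    by (rule summable_on_comparison_test[OF bound]) (use le in auto)
  then have "g summable_on UNIV \<times> UNIV" by (rule abs_summable_summable)
  then obtain S where S: "(g has_sum S) (UNIV \<times> UNIV)"
    by (auto simp: summable_on_def)
  have "((\<lambda>k. \<Sum>l. g (k, l)) has_sum S) UNIV"
    by (rule has_sum_SigmaD[OF S]) (intro norm_summable_imp_has_sum row summable_sums)
  then have "(\<Sum>k. \<Sum>l. g (k, l)) = S"
    by (simp add: has_sum_imp_sums flip: sums_unique)
  moreover have "(\<Sum>l. g (k, l)) = sqrt_coeff k *\<^sub>R (\<Sum>l. sqrt_coeff l *\<^sub>R x (k + l))" for k
  proof -
    have "norm (sqrt_coeff l *\<^sub>R x (k + l)) \<le> (B / 4 ^ k) / 4 ^ l" for l
      using mult_mono[OF abs_sqrt_coeff_le[of l] x[of "k + l"]] by (simp add: power_add)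
    from geometric_suminf_bound(2)[OF _ this]
    have "summable (\<lambda>l. sqrt_coeff l *\<^sub>R x (k + l))"
      using assms(1) by simp
    from suminf_scaleR_right[OF this] show ?thesis by (simp add: g_def)
  qed
  moreover have "S = x 0 - x 1"
  proof (rule has_sum_unique)
    \<comment> \<open>The pair (k, l) is listed under its antidiagonal n = k + l.\<close>
    have "((\<lambda>(n, k). g (k, n - k)) has_sum S) (Sigma UNIV (\<lambda>n. {..n}))"
      using S by (subst has_sum_reindex_bij_witness[of _ "\<lambda>(k, l). (k + l, k)"
            "\<lambda>(n, k). (k, n - k)" "UNIV \<times> UNIV" g _ S]) auto
    then show "((\<lambda>n. \<Sum>k\<le>n. g (k, n - k)) has_sum S) UNIV"
      by (rule has_sum_SigmaD) auto
    have "(\<Sum>k\<le>n. g (k, n - k)) = (if n = 0 then 1 else if n = 1 then -1 else 0) *\<^sub>R x n" for n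
      unfolding sqrt_coeff_convolution[symmetric] scaleR_sum_left
      by (rule sum.cong) (auto simp: g_def)
    then show "((\<lambda>n. \<Sum>k\<le>n. g (k, n - k)) has_sum (x 0 - x 1)) UNIV"
      by (intro has_sum_finite_neutralI[of "{0, 1}"]) auto
  qed
  ultimately show ?thesis by simp
qed

section \<open>Real linearity and boundedness of the triple product\<close>

context jordan_banach_triple
begin

lemma tp_linear_right: "linear (tp x y)"
  by (rule clinear_imp_linear[OF outer_linear])

lemma tp_linear_left: "linear (\<lambda>x. tp x y z)"
  using tp_linear_right[of z y] by (subst outer_sym)

text \<open>Conjugation fixes real scalars, so the middle variable can be treated as a real linear
  one.\<close>

lemma tp_linear_middle: "linear (\<lambda>y. tp x y z)"
proof (rule linearI)
  show "tp x (r *\<^sub>R y) z = r *\<^sub>R tp x y z" for r y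
    using middle_scaleC[of x "complex_of_real r" y z] by (simp add: scaleC_of_real)
qed (rule middle_add)

lemma tp_scaleC_right: "tp x y (c *\<^sub>C z) = c *\<^sub>C tp x y z"
  by (rule clinear_scaleC[OF outer_linear])

lemma tp_scaleC_left: "tp (c *\<^sub>C x) y z = c *\<^sub>C tp x y z"
  by (metis outer_sym tp_scaleC_right)

text \<open>Continuity at the origin bounds the product on small vectors, and homogeneity in each
  slot rescales the bound.\<close>

lemma tp_bounded: "\<exists>K>0. \<forall>x y z. norm (tp x y z) \<le> K * norm x * norm y * norm z"
proof -
  have "isCont (\<lambda>(x, y, z). tp x y z) (0, 0, 0)"
    using tp_continuous by (simp add: continuous_on_eq_continuous_at)
  then obtain d where d: "d > 0"
    "\<And>p. dist p (0, 0, 0) < d \<Longrightarrow> dist ((\<lambda>(x, y, z). tp x y z) p) (tp 0 0 0) < 1"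
    unfolding continuous_at_eps_delta by (metis (mono_tags, lifting) case_prod_conv zero_less_one)
  have tp0 [simp]: "tp 0 y z = 0" "tp x 0 z = 0" "tp x y 0 = 0" for x y z
    using linear_0[OF tp_linear_left] linear_0[OF tp_linear_middle] linear_0[OF tp_linear_right]
    by simp_all
  \<comment> \<open>Three vectors of norm \<open>d / 4\<close> form a triple of norm at most
    \<open>3 * d / 4\<close>, which is below \<open>d\<close>.\<close>
  define e where "e = d / 4"
  have e: "e > 0" using d by (simp add: e_def)
  have small: "norm (tp x y z) \<le> 1" if "norm x = e" "norm y = e" "norm z = e" for x y z
  proof -
    have "norm (x, y, z) \<le> norm x + (norm y + norm z)"
      by (meson norm_Pair_le add_left_mono order_trans)
    also have "\<dots> < d" using that d by (simp add: e_def)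
    finally show ?thesis using d(2)[of "(x, y, z)"] by (simp add: dist_norm flip: zero_prod_def)
  qed
  have "norm (tp x y z) \<le> (1 / e ^ 3) * norm x * norm y * norm z" for x y z
  proof (cases "x = 0 \<or> y = 0 \<or> z = 0")
    case False
    have "norm (tp ((e / norm x) *\<^sub>R x) ((e / norm y) *\<^sub>R y) ((e / norm z) *\<^sub>R z)) \<le> 1"
      by (rule small) (use False e in auto)
    also have "tp ((e / norm x) *\<^sub>R x) ((e / norm y) *\<^sub>R y) ((e / norm z) *\<^sub>R z)
      = (e / norm x) *\<^sub>R (e / norm y) *\<^sub>R (e / norm z) *\<^sub>R tp x y z"
      by (simp only: linear_scale[OF tp_linear_left] linear_scale[OF tp_linear_middle]
          linear_scale[OF tp_linear_right] scaleR_scaleR ac_simps)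
    finally show ?thesis
      using False e by (simp add: field_simps power3_eq_cube)
  qed auto
  then show ?thesis using e by (intro exI[of _ "1 / e ^ 3"]) simp
qed

lemma tp_bounded_linear:
  "bounded_linear (tp x y)" "bounded_linear (\<lambda>x. tp x y z)" "bounded_linear (\<lambda>y. tp x y z)"
proof -
  obtain K where K: "\<And>x y z. norm (tp x y z) \<le> K * norm x * norm y * norm z"
    using tp_bounded by blast
  show "bounded_linear (tp x y)"
    by (rule bounded_linear_intro[of _ "K * norm x * norm y"])
      (use K[of x y] in \<open>simp_all add: linear_add[OF tp_linear_right]
        linear_scale[OF tp_linear_right] ac_simps\<close>)
  show "bounded_linear (\<lambda>x. tp x y z)"
    by (rule bounded_linear_intro[of _ "K * norm y * norm z"])
      (use K[of _ y z] in \<open>simp_all add: linear_add[OF tp_linear_left]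
        linear_scale[OF tp_linear_left] ac_simps\<close>)
  show "bounded_linear (\<lambda>y. tp x y z)"
    by (rule bounded_linear_intro[of _ "K * norm x * norm z"])
      (use K[of x _ z] in \<open>simp_all add: linear_add[OF tp_linear_middle]
        linear_scale[OF tp_linear_middle] ac_simps\<close>)
qed

section \<open>Odd powers and their associativity\<close>

text \<open>In the triple setting only odd powers make sense: \<open>opow a k\<close> plays the role
  of the power of \<open>a\<close> with exponent 2k + 1.\<close>

definition opow :: "'a \<Rightarrow> nat \<Rightarrow> 'a" where
  "opow a k = (tp a a ^^ k) a"

lemma opow_simps [simp]:
  "opow a 0 = a" "tp a a (opow a k) = opow a (Suc k)" "tp a a a = opow a (Suc 0)"
  by (simp_all add: opow_def)

text \<open>Power associativity; the exponents add up as (2i+1) + (2j+1) + (2k+1) = 2(i+j+k+1) + 1.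
  The induction is on the total index, and the defects \<open>f\<close> at one total are related by
  two instances of the Jordan identity, which force them to vanish.\<close>

lemma opow_mult: "tp (opow a i) (opow a j) (opow a k) = opow a (i + j + k + 1)"
proof (induction "i + j + k" arbitrary: i j k rule: less_induct)
  case less
  note IH = less
  show ?case
  proof (cases "i + j + k")
    case 0
    then show ?thesis by simp
  next
    case (Suc n)
    define f where "f i j k = tp (opow a i) (opow a j) (opow a k) - opow a (n + 2)" for i j k
    have sym: "f i j k = f k j i" for i j k
      by (simp add: f_def outer_sym)
    have lower: "tp (opow a i) (opow a j) (opow a k) = opow a (i + j + k + 1)"
      if "i + j + k \<le> n" for i j k
      using IH that Suc by simp
    \<comment> \<open>The Jordan identity for \<open>L(a,a)\<close>, whose left side is known from
      the smaller total.\<close>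
    have rec: "f i (Suc j) k = f (Suc i) j k + f i j (Suc k)" if "i + j + k = n" for i j k
      using jordan_identity[of a a "opow a i" "opow a j" "opow a k"] lower[of i j k] that
      by (simp add: f_def algebra_simps)
    \<comment> \<open>A second relation, from the commutator of \<open>L(opow a i, a)\<close> with
      \<open>L(a,a)\<close>.\<close>
    have jord: "f i 0 (Suc k) = f (Suc i) 0 k - f 0 (Suc i) k" if "i + k = n" for i k
    proof -
      have "tp (opow a i) a a = opow a (Suc i)" by (subst outer_sym) simp
      moreover have "tp a (opow a i) a = opow a (Suc i)"
        using lower[of 0 i 0] that by simp
      moreover have "tp (opow a i) a (opow a k) = opow a (n + 1)"
        using lower[of i 0 k] that by simp
      ultimately show ?thesis
        using jordan_identity[of "opow a i" a a a "opow a k"]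
        by (simp add: f_def algebra_simps)
    qed
    have f0: "f 0 0 (Suc n) = 0" by (simp add: f_def)
    \<comment> \<open>Inner induction on the sum of the first two indices.\<close>
    have zero: "\<forall>l j k. l + j = i \<longrightarrow> l + j + k = Suc n \<longrightarrow> f l j k = 0" for i
    proof (induction i)
      case 0
      then show ?case using f0 by simp
    next
      case (Suc i)
      have step: "f (Suc i) 0 k = 0" if k: "i + k = n" for k
      proof (cases k)
        case 0
        then show ?thesis using f0 sym[of "Suc i" 0 0] k by simp
      next
        case (Suc k')
        \<comment> \<open>The defects one level down vanish, so \<open>rec\<close> makes
          \<open>f\<close> constant on this level; call the value c.\<close>
        have const: "f l j k = f (Suc i) 0 k" if "l + j = Suc i" for l j
          using that
        proof (induction j arbitrary: l)
          case (Suc j)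
          then have "f l j (Suc k) = 0"
            using \<open>\<forall>l j k. l + j = i \<longrightarrow> l + j + k = Suc n \<longrightarrow> f l j k = 0\<close> k by simp
          then show ?case using rec[of l j k] Suc k by simp
        qed simp
        \<comment> \<open>On the next level \<open>rec\<close> then adds c at each step. Going all
          the way yields a total change of (i+2) c, while \<open>jord\<close> says that this change
          is -c; hence c = 0.\<close>
        have "f l j k' = f (i + 2) 0 k' + real j *\<^sub>R f (Suc i) 0 k" if "l + j = i + 2" for l j
          using that
        proof (induction j arbitrary: l)
          case (Suc j)
          then show ?case
            using rec[of l j k'] const[of l j] k \<open>k = Suc k'\<close> by (simp add: algebra_simps)
        qed simp
        from this[of 0 "i + 2"]
        have "f 0 (i + 2) k' = f (i + 2) 0 k' + real (i + 2) *\<^sub>R f (Suc i) 0 k" by simp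
        moreover have "f (Suc i) 0 k = f (i + 2) 0 k' - f 0 (i + 2) k'"
          using jord[of "Suc i" k'] k Suc by simp
        ultimately have "real (i + 2) *\<^sub>R f (Suc i) 0 k = - f (Suc i) 0 k"
          by (metis add_diff_cancel_left' minus_diff_eq)
        then have "(real (i + 2) + 1) *\<^sub>R f (Suc i) 0 k = 0"
          unfolding scaleR_add_left by (simp del: of_nat_add add_2_eq_Suc')
        then show ?thesis by simp
      qed
      have "f l j k = 0" if "l + j = Suc i" "i + k = n" for l j k
        using that(1)
      proof (induction j arbitrary: l)
        case 0
        then show ?case using step that(2) by simp
      next
        case (Suc j)
        then have "f l j (Suc k) = 0"
          using \<open>\<forall>l j k. l + j = i \<longrightarrow> l + j + k = Suc n \<longrightarrow> f l j k = 0\<close> that(2) by simp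
        then show ?case using rec[of l j k] Suc that(2) by simp
      qed
      then show ?case by auto
    qed
    show ?thesis using zero[of "i + j"] Suc by (simp add: f_def)
  qed
qed

section \<open>Powers of \<open>L(a,a)\<close> and the unimodular element\<close>

lemma funpow_L_bounded_linear: "bounded_linear (tp a a ^^ n)"
  by (induction n)
    (simp_all add: bounded_linear_ident id_def o_def bounded_linear_compose[OF tp_bounded_linear(1)])

lemma funpow_L_scaleC: "(tp a a ^^ n) (c *\<^sub>C x) = c *\<^sub>C (tp a a ^^ n) x"
  by (induction n) (simp_all add: tp_scaleC_right)

lemma funpow_L_opow: "(tp a a ^^ n) (opow a k) = opow a (n + k)"
  by (simp add: opow_def funpow_add)

lemma norm_funpow_L_le:
  assumes "\<And>x. norm (tp a a x) \<le> norm x / 2"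
  shows "norm ((tp a a ^^ n) x) \<le> norm x / 2 ^ n"
proof (induction n)
  case (Suc n)
  then show ?case using assms[of "(tp a a ^^ n) x"] by simp
qed simp

text \<open>In the continuous functional calculus of \<open>L(a,a)\<close>, the element \<open>v\<close> below is
  \<open>sqrt (1 - L\<^sup>2) a\<close> and \<open>L a + e v\<close> is a unimodular function of \<open>L\<close> applied to \<open>a\<close>.\<close>

lemma unimodular_element:
  assumes L: "\<And>x. norm (tp a a x) \<le> norm x / 2"
  obtains v where "norm v \<le> 2 * norm a"
    and "\<And>e f. cnj e = - e \<Longrightarrow> e * e = -1 \<Longrightarrow> f = tp a a a + e *\<^sub>C v \<Longrightarrow> tp f f f = tp a a f"
proof
  define P where "P n = tp a a ^^ n" for n
  define v where "v = (\<Sum>k. sqrt_coeff k *\<^sub>R opow a (2 * k))"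
  have bl: "bounded_linear (P n)" for n
    unfolding P_def by (rule funpow_L_bounded_linear)
  have Padd: "P m (P n x) = P (m + n) x" for m n x by (simp add: P_def funpow_add)
  have bound: "norm (sqrt_coeff k *\<^sub>R opow a (2 * k)) \<le> norm a / 4 ^ k" for k
    using mult_mono[OF abs_sqrt_coeff_le[of k] norm_funpow_L_le[OF L, of "2 * k" a]]
    by (simp add: opow_def power_mult)
  note v_sum = geometric_suminf_bound[OF norm_ge_zero bound]
  show "norm v \<le> 2 * norm a" using v_sum(3) by (simp add: v_def)
  \<comment> \<open>The coefficients are real, so real linearity of \<open>A\<close> is enough; this
    covers the middle slot of the product as well.\<close>
  have apply_v: "A v = (\<Sum>k. sqrt_coeff k *\<^sub>R A (opow a (2 * k)))" if "bounded_linear A"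
    for A :: "'a \<Rightarrow> 'a"
    unfolding v_def by (simp add: bounded_linear.suminf[OF that v_sum(2)]
        linear_scale[OF bounded_linear.linear[OF that]])
  have tp_v: "tp (opow a i) (opow a j) v = P (i + j + 1) v" for i j
    unfolding apply_v[OF bl] apply_v[OF tp_bounded_linear(1)] opow_mult
    by (simp add: P_def funpow_L_opow del: funpow.simps)
  \<comment> \<open>Here \<open>e\<close> stands for either square root of -1, so that both
    conjugate elements are treated at once.\<close>
  fix e f
  assume e: "cnj e = - e" "e * e = -1" and f: "f = tp a a a + e *\<^sub>C v"
  \<comment> \<open>Multiplying by two powers of \<open>a\<close> acts on \<open>f\<close> as a
    power of \<open>L(a,a)\<close>, by power associativity applied termwise.\<close>
  have tp_f: "tp (opow a i) (opow a j) f = P (i + j + 1) f" for i j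
  proof -
    have "tp (opow a i) (opow a j) f = opow a (i + j + 1 + 1) + e *\<^sub>C P (i + j + 1) v"
      unfolding f by (simp add: linear_add[OF tp_linear_right] tp_scaleC_right tp_v opow_mult)
    also have "\<dots> = P (i + j + 1) f"
      unfolding f linear_add[OF bounded_linear.linear[OF bl]]
      by (simp add: P_def funpow_L_opow funpow_L_scaleC del: funpow.simps)
    finally show ?thesis .
  qed
  have v_pow: "tp v (opow a j) f = (\<Sum>l. sqrt_coeff l *\<^sub>R P (2 * l + j + 1) f)" for j
    unfolding apply_v[OF tp_bounded_linear(2)] tp_f ..
  have pow_v: "tp (opow a 1) v f = tp v (opow a 1) f"
    unfolding v_pow apply_v[OF tp_bounded_linear(3)] tp_f by (simp add: ac_simps)
  \<comment> \<open>Both factors \<open>v\<close> contribute sqrt (1 - L^2), so the double sum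
    collapses to (1 - L^2) L f.\<close>
  have "tp v v f = (\<Sum>k. sqrt_coeff k *\<^sub>R (\<Sum>l. sqrt_coeff l *\<^sub>R P (2 * (k + l) + 1) f))"
    unfolding apply_v[OF tp_bounded_linear(3)[of v]] v_pow by (simp add: algebra_simps)
  also have "\<dots> = P 1 f - P 3 f"
  proof (subst sqrt_coeff_double_sum[where B = "norm f" and x = "\<lambda>n. P (2 * n + 1) f"])
    show "norm (P (2 * n + 1) f) \<le> norm f / 4 ^ n" for n
    proof -
      have "(2::real) ^ (2 * n + 1) = 2 * 4 ^ n" by (simp add: power_mult)
      with norm_funpow_L_le[OF L, of "2 * n + 1" f]
      have "norm (P (2 * n + 1) f) \<le> norm f / (2 * 4 ^ n)" unfolding P_def by simp
      also have "\<dots> \<le> norm f / 4 ^ n" by (simp add: field_simps)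
      finally show ?thesis .
    qed
  qed (simp_all add: numeral_3_eq_3)
  finally have v_v: "tp v v f = P 1 f - P 3 f" .
  have "tp f f f = tp (opow a 1 + e *\<^sub>C v) (opow a 1 + e *\<^sub>C v) f"
    by (simp add: f)
  \<comment> \<open>The mixed terms agree by \<open>pow_v\<close> and cancel since
    \<open>cnj e = - e\<close>; the last term has coefficient \<open>e * cnj e = 1\<close>, and L^3
    f + (L - L^3) f = L f.\<close>
  also have "\<dots> = tp (opow a 1) (opow a 1) f + cnj e *\<^sub>C tp (opow a 1) v f
      + e *\<^sub>C (tp v (opow a 1) f + cnj e *\<^sub>C tp v v f)"
    by (simp only: linear_add[OF tp_linear_left] middle_add middle_scaleC tp_scaleC_left
        scaleC_add_right scaleC_scaleC ac_simps)
  also have "\<dots> = P 3 f + (P 1 f - P 3 f)"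
    using scaleC_of_real[of 1 "P 1 f - P 3 f"]
    by (simp only: pow_v v_v tp_f e scaleC_add_right scaleC_scaleC)
      (simp add: e scaleC_minus_left numeral_3_eq_3)
  finally show "tp f f f = tp a a f" by (simp add: P_def)
qed

end

section \<open>Cubic estimates and automatic continuity\<close>

lemma generalised_triple_hom_bounded_near_0:
  assumes "jordan_banach_triple tpE" and "jordan_banach_triple tpF"
    and cube: "\<And>z. norm (tpF z z z) = norm z ^ 3"
    and T: "generalised_triple_hom tpE tpF T"
  obtains d B where "d > 0" and "\<And>a. norm a \<le> d \<Longrightarrow> norm (T a) \<le> B"
proof -
  interpret E: jordan_banach_triple tpE by fact
  interpret F: jordan_banach_triple tpF by fact
  obtain K where K: "K > 0" "\<And>x y z. norm (tpE x y z) \<le> K * norm x * norm y * norm z"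
    using E.tp_bounded by blast
  obtain M where M: "M > 0" "\<And>x y z. norm (tpF x y z) \<le> M * norm x * norm y * norm z"
    using F.tp_bounded by blast
  obtain C where T_lin: "clinear T" and C: "C > 0"
    "\<And>a b c. norm (T (tpE a b c) - tpF (T a) (T b) (T c)) \<le> C * norm a * norm b * norm c"
    using T unfolding generalised_triple_hom_def by blast
  \<comment> \<open>This choice makes \<open>K * norm a * norm a\<close> at most 1/2, so that
    \<open>L(a,a)\<close> has norm at most 1/2.\<close>
  define d where "d = min 1 (1 / (2 * K))"
  have d: "0 < d" "d \<le> 1" "K * d \<le> 1 / 2" 
    using K(1) by (auto simp: d_def min_def field_simps)
  \<comment> \<open>With \<open>norm f\<close> at most 3, the two errors of \<open>T\<close> below
    are at most \<open>3 * C\<close> and \<open>27 * C\<close>, which gives 30.\<close>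
  define A where "A = M + 30 * C"
  have "norm (T a) \<le> 1 + A + C" if a: "norm a \<le> d" for a
  proof (cases "norm (T a) \<le> 1")
    case True
    then show ?thesis using M(1) C(1) by (simp add: A_def)
  next
    case False
    define t where "t = norm (T a)"
    have t: "1 < t" using False by (simp add: t_def)
    have a1: "norm a \<le> 1" using a d by simp
    have "K * norm a * norm a \<le> K * d * 1"
      using a d a1 K(1) by (intro mult_mono) auto
    then have "norm (tpE a a x) \<le> norm x / 2" for x
      using K(2)[of a a x] mult_right_mono[of "K * norm a * norm a" "1/2" "norm x"] d by simp
    from E.unimodular_element[OF this] obtain v where v: "norm v \<le> 2 * norm a"
      and uni: "\<And>e f. cnj e = - e \<Longrightarrow> e * e = -1 \<Longrightarrow> f = tpE a a a + e *\<^sub>C v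
          \<Longrightarrow> tpE f f f = tpE a a f"
      by blast
    have L: "norm (tpE a a a) \<le> 1"
      using \<open>norm (tpE a a a) \<le> norm a / 2\<close> a1 by simp
    \<comment> \<open>The summand 1 in the factor covers the case in which \<open>norm (T f)\<close>
      does not exceed \<open>t\<close>.\<close>
    have main: "norm (T f) \<le> (1 + A) * t"
      if e: "cnj e = - e" "e * e = -1" "cmod e = 1" and f: "f = tpE a a a + e *\<^sub>C v" for e f
    proof -
      define y where "y = norm (T f)"
      have nf: "norm f \<le> 3"
        unfolding f using norm_triangle_ineq[of "tpE a a a" "e *\<^sub>C v"] L v a1 e(3)
        by (simp add: norm_scaleC)
      have "y ^ 3 \<le> norm (T (tpE f f f)) + C * norm f * norm f * norm f"
        unfolding y_def cube[symmetric] using C(2)[of f f f]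
        by (smt (verit) norm_minus_commute norm_triangle_ineq2)
      also have "T (tpE f f f) = T (tpE a a f)" using uni[OF e(1,2) f] by simp
      also have "norm (T (tpE a a f)) \<le> norm (tpF (T a) (T a) (T f)) + C * norm a * norm a * norm f"
        using C(2)[of a a f] by (smt (verit) norm_triangle_ineq2)
      also have "norm (tpF (T a) (T a) (T f)) \<le> M * t * t * y"
        unfolding t_def y_def by (rule M(2))
      also have "C * norm a * norm a * norm f \<le> C * 1 * 1 * 3"
        using C(1) a1 nf by (intro mult_mono) auto
      also have "C * norm f * norm f * norm f \<le> C * 3 * 3 * 3"
        using C(1) nf by (intro mult_mono) auto
      finally have y3: "y ^ 3 \<le> M * t * t * y + 30 * C" by simp
      show ?thesis
      proof (cases "y \<le> t")
        case True
        then show ?thesis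
          using t M(1) C(1) by (simp add: y_def A_def algebra_simps)
            (smt (verit) mult_nonneg_nonneg)
      next
        case False
        then have y: "t < y" "1 < y" using t by auto
        \<comment> \<open>As \<open>t\<close> and \<open>y\<close> exceed 1, the constant
          \<open>30 * C\<close> is absorbed into the term \<open>t * t * y\<close>; dividing by
          \<open>y\<close> and using \<open>t < y\<close> leaves a bound linear in
          \<open>t\<close>.\<close>
        have "1 \<le> t * t * y"
          using t y by (metis less_imp_le mult_ge1_I)
        then have "30 * C * 1 \<le> 30 * C * (t * t * y)"
          using C(1) by (intro mult_left_mono) auto
        then have "y ^ 3 \<le> A * (t * t) * y" using y3 by (simp add: A_def algebra_simps)
        then have "y * y \<le> A * (t * t)"
          using y by (simp add: power3_eq_cube)
        also have "\<dots> \<le> A * (t * y)" using y t C(1) M(1)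
          by (intro mult_left_mono) (auto simp: A_def)
        finally have "y \<le> A * t" using y by simp
        then show ?thesis using t by (simp add: y_def algebra_simps)
      qed
    qed
    let ?p = "tpE a a a + \<i> *\<^sub>C v" and ?q = "tpE a a a + (- \<i>) *\<^sub>C v"
    have "T ?p + T ?q = 2 *\<^sub>R T (tpE a a a)"
      by (simp add: scaleC_minus_left flip: clinear_add[OF T_lin]
          linear_scale[OF clinear_imp_linear[OF T_lin]] scaleR_2)
    then have "2 * norm (T (tpE a a a)) = norm (T ?p + T ?q)" by simp
    also have "\<dots> \<le> norm (T ?p) + norm (T ?q)" by (rule norm_triangle_ineq)
    also have "\<dots> \<le> 2 * ((1 + A) * t)"
      using main[of \<i> ?p] main[of "- \<i>" ?q] by simp
    finally have Ta3: "norm (T (tpE a a a)) \<le> (1 + A) * t" by simp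
    \<comment> \<open>The cube of \<open>t\<close> is now bounded linearly in \<open>t\<close>;
      dividing by \<open>t\<close> bounds its square, and \<open>t\<close> lies below its square
      because it exceeds 1.\<close>
    have "t ^ 3 \<le> norm (T (tpE a a a)) + C * norm a * norm a * norm a"
      unfolding t_def cube[symmetric] using C(2)[of a a a]
      by (smt (verit) norm_minus_commute norm_triangle_ineq2)
    also have "C * norm a * norm a * norm a \<le> C * 1 * 1 * 1"
      using C(1) a1 by (intro mult_mono) auto
    also have "C * 1 * 1 * 1 \<le> C * t" using t C(1) by simp
    finally have "t * t * t \<le> (1 + A + C) * t"
      using Ta3 by (simp add: power3_eq_cube algebra_simps)
    then have "t * t \<le> 1 + A + C" using t by simp
    moreover have "t * 1 \<le> t * t" using t by (intro mult_left_mono) auto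
    ultimately show ?thesis by (simp add: t_def)
  qed
  then show ?thesis using that d(1) by blast
qed

theorem theorem8:
  fixes tpE :: "'a::cbanach \<Rightarrow> 'a \<Rightarrow> 'a \<Rightarrow> 'a"
    and tpF :: "'b::cbanach \<Rightarrow> 'b \<Rightarrow> 'b \<Rightarrow> 'b"
    and T :: "'a \<Rightarrow> 'b"
  assumes "jb_star_triple tpE" and "jb_star_triple tpF"
    and "generalised_triple_hom tpE tpF T"
  shows "continuous_on UNIV T"
proof -
  interpret E: jb_star_triple tpE by fact
  interpret F: jb_star_triple tpF by fact
  obtain d B where d: "d > 0" and B: "\<And>a. norm a \<le> d \<Longrightarrow> norm (T a) \<le> B"
    using generalised_triple_hom_bounded_near_0[OF E.jordan_banach_triple_axioms
        F.jordan_banach_triple_axioms F.norm_cube assms(3)] by blast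
  have lin: "linear T"
    using assms(3) unfolding generalised_triple_hom_def by (blast intro: clinear_imp_linear)
  \<comment> \<open>Each nonzero vector is scaled to norm \<open>d\<close>, where \<open>B\<close>
    applies.\<close>
  have "norm (T x) \<le> norm x * (B / d)" for x
  proof (cases "x = 0")
    case False
    have "norm (T ((d / norm x) *\<^sub>R x)) \<le> B" by (rule B) (use False d in simp)
    then show ?thesis using False d by (simp add: linear_scale[OF lin] field_simps)
  qed (simp add: linear_0[OF lin])
  then have "bounded_linear T"
    using lin by (intro bounded_linear_intro[of _ "B / d"]) (simp_all add: linear_add linear_scale)
  then show ?thesis by (rule linear_continuous_on)
qed

end
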